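(* Let $f:\mathbb{R}\to\mathbb{R}$ be a piecewise linear map with rational slopes and having only finitely many non-differentiable points. Then there is a constant $k_f$, depending only on $f$, such that the following holds: for every irrational number $\alpha>0$, every integer $M>1$ and every positive rational number $P$, when the values $f(m\alpha)$, $1\le m\le M$, are inserted mod $P$ in $[0,P)$ and arranged in ascending order, the gaps (differences) between successive terms take at most $k_f$ distinct values.
   Context: Here a piecewise linear map with rational slopes and finitely many non-differentiable points means that $\mathbb{R}$ can be partitioned into finitely many intervals on each of which $f$ agrees with a map of the form $x\mapsto ax+b$ with $a\in\mathbb{Q}$ and $b\in\mathbb{R}$ (so "linear" means affine). Inserting a real number $y$ mod $P$ into $[0,P)$ means taking the unique element of $[0,P)$ that differs from $y$ by an integer multiple of $P$. The values are counted with multiplicity, one for each $m$, so coincident values are allowed. *)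

theory Defs
  imports "HOL-Analysis.Analysis" "HOL-Library.Disjoint_Sets" "HOL-Library.Real_Mod"
begin

text \<open>
  The pieces may be arbitrary intervals (open, closed, half-open, unbounded, or single points),
  and no continuity at the breakpoints is required. Non-differentiability can only occur at
  endpoints of the finitely many pieces.
\<close>

definition piecewise_linear_rational_slopes :: "(real \<Rightarrow> real) \<Rightarrow> bool" where
  "piecewise_linear_rational_slopes f \<longleftrightarrow>
     (\<exists>\<I>. finite \<I> \<and> partition_on UNIV \<I> \<and>
        (\<forall>I\<in>\<I>. is_interval I \<and> (\<exists>a\<in>\<rat>. \<exists>b::real. \<forall>x\<in>I. f x = a * x + b)))"

text \<open>The library's \<open>rmod\<close> is reduction into \<open>[0,P)\<close>:\<close>

lemma rmod_in_interval_unique: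
  fixes P y z :: real
  assumes "P > 0"
  shows "z = y rmod P \<longleftrightarrow> z \<in> {0..<P} \<and> (\<exists>k::int. y - z = of_int k * P)"
proof
  assume z: "z = y rmod P"
  have "y - z = of_int \<lfloor>y / P\<rfloor> * P"
    using z assms by (simp add: rmod_def mult.commute)
  moreover have "z \<in> {0..<P}"
    using z assms rmod_nonneg[of P y] rmod_less[of P y] by simp
  ultimately show "z \<in> {0..<P} \<and> (\<exists>k::int. y - z = of_int k * P)" by blast
next
  assume "z \<in> {0..<P} \<and> (\<exists>k::int. y - z = of_int k * P)"
  then obtain k :: int where k: "y = z + of_int k * P" and z: "0 \<le> z" "z < P"
    by (auto simp: algebra_simps)
  have "\<lfloor>y / P\<rfloor> = k"
    using k z assms by (intro floor_unique) (auto simp: field_simps)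
  then show "z = y rmod P" using k assms by (simp add: rmod_def)
qed

text \<open>Sorting a list keeps repeated values, so coincident values give rise to the gap \<open>0\<close>.
  There is no wrap-around gap from the largest value back to the smallest.\<close>

definition sorted_values_mod :: "(real \<Rightarrow> real) \<Rightarrow> real \<Rightarrow> nat \<Rightarrow> real \<Rightarrow> real list" where
  "sorted_values_mod f \<alpha> M P = sort (map (\<lambda>m. f (real m * \<alpha>) rmod P) [1..<Suc M])"

definition successive_gaps :: "real list \<Rightarrow> real set" where
  "successive_gaps xs = {xs ! Suc i - xs ! i | i. Suc i < length xs}"

lemma finite_successive_gaps: "finite (successive_gaps xs)"
proof -
  have "successive_gaps xs \<subseteq> (\<lambda>i. xs ! Suc i - xs ! i) ` {..<length xs}"
    by (auto simp: successive_gaps_def)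
  then show ?thesis by (rule finite_subset) simp
qed

end

theory Submission
  imports Defs
begin

text \<open>
  The points are put on the circle of circumference \<open>P\<close>, or equivalently on the line as a set \<open>S\<close>
  that is invariant under translation by \<open>P\<close>. On a piece of slope \<open>a\<close> the values form a stretch
  of an arithmetic progression with difference \<open>a * \<alpha>\<close>. The finitely many nonzero slopes are
  rational, so they have a common nonzero integer multiple \<open>c = a * t\<close>. Translation by
  \<open>\<beta> = c * \<alpha>\<close> then moves \<open>t\<close> steps along every such progression at once. It therefore maps \<open>S\<close>
  into itself except near the ends of these stretches: all but at most \<open>\<bar>t\<bar>\<close> of the points of a
  stretch have their translate in \<open>S\<close>, and the same holds for translation by \<open>-\<beta>\<close>
  (\<open>few_boundary_values\<close>). A piece of slope zero adds only one value.

  The rest is Liang's argument for the \<open>3d\<close>-distance theorem of Chung and Graham. Translating a gap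
  of \<open>S\<close> repeatedly by \<open>\<beta>\<close> must at some moment give something that is not a gap, because \<open>S\<close> is
  finite modulo \<open>P\<close> while \<open>\<beta> / P\<close> is irrational. Hence every gap length occurs at a gap whose
  translate fails to be a gap, and each such failure is caused by a boundary point, at most three
  failures for each (\<open>card_gap_lengths_le\<close>). The number of lengths is thus bounded by the pieces
  and the multipliers \<open>t\<close> alone. Coincident values add at most the length \<open>0\<close>.
\<close>

section \<open>Gaps of a periodic set\<close>

definition periodize :: "real \<Rightarrow> real set \<Rightarrow> real set" where
  "periodize P A = {v + of_int k * P | v k. v \<in> A}"

definition consecutive_in :: "real set \<Rightarrow> real \<Rightarrow> real \<Rightarrow> bool" where
  "consecutive_in S x y \<longleftrightarrow> x \<in> S \<and> y \<in> S \<and> x < y \<and> {x<..<y} \<inter> S = {}"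

lemma periodize_add_iff:
  "x + of_int k * P \<in> periodize P A \<longleftrightarrow> x \<in> periodize P A"
proof -
  have shift: "x + of_int k * P \<in> periodize P A" if x: "x \<in> periodize P A" for x and k :: int
  proof -
    obtain v j where "v \<in> A" "x = v + of_int j * P"
      using x by (auto simp: periodize_def)
    then have "x + of_int k * P = v + of_int (j + k) * P"
      by (simp add: algebra_simps)
    with \<open>v \<in> A\<close> show ?thesis unfolding periodize_def by blast
  qed
  show ?thesis
    using shift[of x k] shift[of "x + of_int k * P" "- k"] by auto
qed

lemma consecutive_in_periodize_add:
  assumes "consecutive_in (periodize P A) (x + of_int k * P) (y + of_int k * P)"
  shows "consecutive_in (periodize P A) x y"
proof -
  have "z \<notin> periodize P A" if "x < z" "z < y" for z
  proof
    assume "z \<in> periodize P A"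
    then have "z + of_int k * P \<in> periodize P A" by (simp add: periodize_add_iff)
    moreover have "z + of_int k * P \<in> {x + of_int k * P<..<y + of_int k * P}"
      using that by simp
    ultimately show False using assms unfolding consecutive_in_def by blast
  qed
  then show ?thesis
    using assms by (auto simp: consecutive_in_def periodize_add_iff)
qed

lemma consecutive_in_unique:
  assumes "consecutive_in S x y" "consecutive_in S x' y'"
    and "max x x' < min y y'"
  shows "x = x' \<and> y = y'"
proof -
  have mem: "x \<in> S" "y \<in> S" "x' \<in> S" "y' \<in> S"
    and empty: "\<And>z. z \<in> S \<Longrightarrow> \<not> (x < z \<and> z < y)" "\<And>z. z \<in> S \<Longrightarrow> \<not> (x' < z \<and> z < y')"
    using assms(1,2) by (auto simp: consecutive_in_def)
  have lt: "x < y'" "x' < y" using assms(3) by auto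
  have "x = x'" using empty(1)[OF mem(3)] empty(2)[OF mem(1)] lt by auto
  moreover have "y = y'" using empty(1)[OF mem(4)] empty(2)[OF mem(2)] lt by auto
  ultimately show ?thesis ..
qed

text \<open>
  If the gap could be translated by \<open>\<beta>\<close> forever, its left endpoint would have infinitely many
  translates in \<open>periodize P A\<close>. There are only finitely many residues modulo \<open>P\<close>, so two
  of the translates would be congruent, and this makes \<open>\<beta>\<close> commensurable with \<open>P\<close>.
\<close>

lemma gap_with_nonconsecutive_translate:
  assumes "P > 0" "finite A"
    and irr: "\<And>n k. of_nat n * \<beta> = of_int k * P \<Longrightarrow> n = 0"
    and gap: "consecutive_in (periodize P A) x y"
  obtains x' y' where "consecutive_in (periodize P A) x' y'" "y' - x' = y - x"
    "\<not> consecutive_in (periodize P A) (x' + \<beta>) (y' + \<beta>)"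
proof (rule ccontr)
  assume no: "\<not> thesis"
  have all: "consecutive_in (periodize P A) (x + of_nat n * \<beta>) (y + of_nat n * \<beta>)" for n
  proof (induction n)
    case 0
    show ?case using gap by simp
  next
    case (Suc n)
    have "consecutive_in (periodize P A) (x + of_nat n * \<beta> + \<beta>) (y + of_nat n * \<beta> + \<beta>)"
      using no that[OF Suc] by auto
    then show ?case by (simp add: algebra_simps)
  qed
  have "\<exists>v\<in>A. \<exists>k. x + of_nat n * \<beta> = v + of_int k * P" for n
    using all[of n] by (auto simp: consecutive_in_def periodize_def)
  then obtain v k where v: "\<And>n. v n \<in> A"
    and k: "\<And>n. x + of_nat n * \<beta> = v n + of_int (k n) * P" by metis
  have "\<not> inj v"
    using finite_subset[of "range v" A] v \<open>finite A\<close> finite_imageD[of v UNIV] by auto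
  then obtain i j where ij: "v i = v j" "i < j"
    by (metis injI linorder_neqE_nat)
  have "of_nat (j - i) * \<beta> = of_int (k j - k i) * P"
    using k[of i] k[of j] ij by (simp add: of_nat_diff algebra_simps)
  from irr[OF this] ij show False by simp
qed

lemma card_le_of_functional_relation:
  assumes "finite F" "\<And>l. l \<in> B \<Longrightarrow> \<exists>v\<in>F. R v l"
    and "\<And>v l l'. R v l \<Longrightarrow> R v l' \<Longrightarrow> l = l'"
  shows "finite B \<and> card B \<le> card F"
proof -
  have "B \<subseteq> (\<lambda>v. THE l. R v l) ` F"
  proof
    fix l assume "l \<in> B"
    then obtain v where "v \<in> F" "R v l" using assms(2) by blast
    then have "(THE l. R v l) = l" using assms(3) by (blast intro: the_equality)
    then show "l \<in> (\<lambda>v. THE l. R v l) ` F" using \<open>v \<in> F\<close> by force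
  qed
  then show ?thesis
    using assms(1) by (meson card_image_le card_mono finite_imageI finite_subset le_trans)
qed

text \<open>
  A gap whose translate by \<open>\<beta>\<close> is not a gap has one of three defects: its left endpoint leaves
  the set, its right endpoint leaves the set, or a point without preimage in the set lands
  strictly inside the translate. In each case a single boundary point, taken modulo \<open>P\<close>,
  pins down the gap, which gives the factor 3.
\<close>

lemma card_gap_lengths_le:
  assumes "P > 0" "finite A" "finite F"
    and irr: "\<And>n k. of_nat n * \<beta> = of_int k * P \<Longrightarrow> n = 0"
    and last: "\<And>x. x \<in> periodize P A \<Longrightarrow> x + \<beta> \<notin> periodize P A \<Longrightarrow> x \<in> periodize P F"
    and first: "\<And>x. x \<in> periodize P A \<Longrightarrow> x - \<beta> \<notin> periodize P A \<Longrightarrow> x \<in> periodize P F"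
  defines "L \<equiv> {y - x | x y. consecutive_in (periodize P A) x y}"
  shows "finite L \<and> card L \<le> 3 * card F"
proof -
  let ?S = "periodize P A"
  define B1 where "B1 = {y - x | x y. consecutive_in ?S x y \<and> x + \<beta> \<notin> ?S}"
  define B2 where "B2 = {y - x | x y. consecutive_in ?S x y \<and> y + \<beta> \<notin> ?S}"
  define B3 where "B3 = {y - x | x y. consecutive_in ?S x y \<and>
    (\<exists>z\<in>?S. x + \<beta> < z \<and> z < y + \<beta> \<and> z - \<beta> \<notin> ?S)}"
  have cover: "L \<subseteq> B1 \<union> B2 \<union> B3"
  proof
    fix l assume "l \<in> L"
    then obtain x y where xy: "consecutive_in ?S x y" "l = y - x" by (auto simp: L_def)
    obtain x' y' where g: "consecutive_in ?S x' y'" and "y' - x' = y - x"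
      and n: "\<not> consecutive_in ?S (x' + \<beta>) (y' + \<beta>)"
      by (rule gap_with_nonconsecutive_translate[OF \<open>P > 0\<close> \<open>finite A\<close> irr xy(1)])
    then have l: "l = y' - x'" using xy by simp
    consider "x' + \<beta> \<notin> ?S" | "y' + \<beta> \<notin> ?S" | z where "z \<in> ?S" "x' + \<beta> < z" "z < y' + \<beta>"
      using n g unfolding consecutive_in_def by auto
    then show "l \<in> B1 \<union> B2 \<union> B3"
    proof cases
      case 1
      then show ?thesis using g l unfolding B1_def by blast
    next
      case 2
      then show ?thesis using g l unfolding B2_def by blast
    next
      case 3
      have "z - \<beta> \<in> {x'<..<y'}" using 3 by auto
      then have "z - \<beta> \<notin> ?S" using g unfolding consecutive_in_def by blast
      then show ?thesis using g l 3 unfolding B3_def by blast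
    qed
  qed
  have B1: "finite B1 \<and> card B1 \<le> card F"
  proof (rule card_le_of_functional_relation[OF \<open>finite F\<close>,
        where R = "\<lambda>v l. consecutive_in ?S v (v + l)"])
    fix l assume "l \<in> B1"
    then obtain x y where g: "consecutive_in ?S x y" "x + \<beta> \<notin> ?S" "l = y - x"
      by (auto simp: B1_def)
    then obtain v k where v: "v \<in> F" "x = v + of_int k * P"
      using last[of x] by (auto simp: periodize_def consecutive_in_def)
    have "consecutive_in ?S v (v + l)"
    proof (rule consecutive_in_periodize_add)
      have "v + l + of_int k * P = y" using g v by simp
      then show "consecutive_in ?S (v + of_int k * P) (v + l + of_int k * P)" using g v by simp
    qed
    then show "\<exists>v\<in>F. consecutive_in ?S v (v + l)" using v by blast
  next
    fix v l l' assume a: "consecutive_in ?S v (v + l)" "consecutive_in ?S v (v + l')"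
    then show "l = l'"
      using consecutive_in_unique[OF a] by (auto simp: consecutive_in_def)
  qed
  have B2: "finite B2 \<and> card B2 \<le> card F"
  proof (rule card_le_of_functional_relation[OF \<open>finite F\<close>,
        where R = "\<lambda>v l. consecutive_in ?S (v - l) v"])
    fix l assume "l \<in> B2"
    then obtain x y where g: "consecutive_in ?S x y" "y + \<beta> \<notin> ?S" "l = y - x"
      by (auto simp: B2_def)
    then obtain v k where v: "v \<in> F" "y = v + of_int k * P"
      using last[of y] by (auto simp: periodize_def consecutive_in_def)
    have "consecutive_in ?S (v - l) v"
    proof (rule consecutive_in_periodize_add)
      have "v - l + of_int k * P = x" using g v by simp
      then show "consecutive_in ?S (v - l + of_int k * P) (v + of_int k * P)" using g v by simp
    qed
    then show "\<exists>v\<in>F. consecutive_in ?S (v - l) v" using v by blast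
  next
    fix v l l' assume a: "consecutive_in ?S (v - l) v" "consecutive_in ?S (v - l') v"
    then show "l = l'"
      using consecutive_in_unique[OF a] by (auto simp: consecutive_in_def)
  qed
  have B3: "finite B3 \<and> card B3 \<le> card F"
  proof (rule card_le_of_functional_relation[OF \<open>finite F\<close>,
        where R = "\<lambda>v l. \<exists>x. consecutive_in ?S x (x + l) \<and> x < v - \<beta> \<and> v - \<beta> < x + l"])
    fix l assume "l \<in> B3"
    then obtain x y z where g: "consecutive_in ?S x y" "z \<in> ?S" "x + \<beta> < z" "z < y + \<beta>"
        "z - \<beta> \<notin> ?S" "l = y - x"
      by (auto simp: B3_def)
    then obtain v k where v: "v \<in> F" "z = v + of_int k * P"
      using first[of z] by (auto simp: periodize_def)
    have "consecutive_in ?S (x - of_int k * P) (x - of_int k * P + l)"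
    proof (rule consecutive_in_periodize_add)
      have "x - of_int k * P + of_int k * P = x" "x - of_int k * P + l + of_int k * P = y"
        using g by simp_all
      then show "consecutive_in ?S (x - of_int k * P + of_int k * P)
          (x - of_int k * P + l + of_int k * P)" using g by simp
    qed
    moreover have "x - of_int k * P < v - \<beta>" "v - \<beta> < x - of_int k * P + l"
      using g v by auto
    ultimately show "\<exists>v\<in>F. \<exists>x. consecutive_in ?S x (x + l) \<and> x < v - \<beta> \<and> v - \<beta> < x + l"
      using v by blast
  next
    fix v l l'
    assume "\<exists>x. consecutive_in ?S x (x + l) \<and> x < v - \<beta> \<and> v - \<beta> < x + l"
      and "\<exists>x. consecutive_in ?S x (x + l') \<and> x < v - \<beta> \<and> v - \<beta> < x + l'"
    then obtain x x' where a: "consecutive_in ?S x (x + l)" "consecutive_in ?S x' (x' + l')"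
      and "x < v - \<beta>" "v - \<beta> < x + l" "x' < v - \<beta>" "v - \<beta> < x' + l'" by blast
    then have "max x x' < min (x + l) (x' + l')" by linarith
    from consecutive_in_unique[OF a this] show "l = l'" by simp
  qed
  have "card L \<le> card (B1 \<union> B2 \<union> B3)"
    using cover B1 B2 B3 by (intro card_mono) auto
  also have "\<dots> \<le> card B1 + card B2 + card B3"
    by (meson add_le_mono card_Un_le le_trans order_refl)
  finally show ?thesis
    using B1 B2 B3 cover finite_subset[of L "B1 \<union> B2 \<union> B3"] by simp
qed

section \<open>Values of a piecewise linear map along a progression\<close>

lemma common_multiple_of_rationals:
  fixes R :: "real set"
  assumes "finite R" "R \<subseteq> \<rat> - {0}"
  shows "\<exists>c\<in>\<rat> - {0}. \<forall>a\<in>R. \<exists>t::int. t \<noteq> 0 \<and> c = a * of_int t"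
  using assms
proof (induction R)
  case empty
  show ?case by (auto intro!: bexI[of _ 1])
next
  case (insert a R)
  then obtain c where c: "c \<in> \<rat>" "c \<noteq> 0" "\<forall>a\<in>R. \<exists>t::int. t \<noteq> 0 \<and> c = a * of_int t" by auto
  have "c / a \<in> \<rat>" "c / a \<noteq> 0" using c insert.prems by auto
  then obtain p q :: int where pq: "q \<noteq> 0" "c / a = of_int p / of_int q"
    by (metis Rats_cases' of_int_0 less_irrefl)
  have "p \<noteq> 0" using pq \<open>c / a \<noteq> 0\<close> by auto
  have "a \<noteq> 0" using insert.prems by auto
  then have new: "c * of_int q = a * of_int p" using pq by (simp add: field_simps)
  have "\<exists>t::int. t \<noteq> 0 \<and> c * of_int q = a' * of_int t" if "a' \<in> insert a R" for a'
  proof (cases "a' = a")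
    case True
    then show ?thesis using new \<open>p \<noteq> 0\<close> by blast
  next
    case False
    then have "a' \<in> R" using that by simp
    then obtain t :: int where "t \<noteq> 0" "c = a' * of_int t" using c(3) by blast
    then have "t * q \<noteq> 0" "c * of_int q = a' * of_int (t * q)" using pq by auto
    then show ?thesis by blast
  qed
  then show ?case using c pq by (intro bexI[of _ "c * of_int q"]) auto
qed

text \<open>
  Two elements of \<open>J\<close> in the same residue class modulo \<open>t\<close> are joined by a chain of steps of
  size \<open>\<bar>t\<bar>\<close> inside \<open>J\<close>, so in each class only one element can leave \<open>J\<close> under the step.
\<close>

lemma card_exits_of_order_convex_le:
  fixes J :: "int set" and t :: int
  assumes conv: "\<And>x y z. x \<in> J \<Longrightarrow> z \<in> J \<Longrightarrow> x \<le> y \<Longrightarrow> y \<le> z \<Longrightarrow> y \<in> J" and "t \<noteq> 0"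
  shows "card {m \<in> J. m + t \<notin> J} \<le> nat \<bar>t\<bar>"
proof -
  let ?E = "{m \<in> J. m + t \<notin> J}"
  have no: False if "m \<in> ?E" "n \<in> ?E" "m < n" "m mod \<bar>t\<bar> = n mod \<bar>t\<bar>" for m n
  proof -
    have "\<bar>t\<bar> dvd n - m" using that(4) by (metis mod_eq_dvd_iff)
    then have "\<bar>t\<bar> \<le> n - m" using that(3) by (intro zdvd_imp_le) auto
    then show False
      using that conv[of m n "m + t"] conv[of m n "n + t"] by (cases "t > 0") auto
  qed
  have "inj_on (\<lambda>m. m mod \<bar>t\<bar>) ?E"
    by (rule linorder_inj_onI) (use no in \<open>auto\<close>)
  moreover have "(\<lambda>m. m mod \<bar>t\<bar>) ` ?E \<subseteq> {0..<\<bar>t\<bar>}"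
    using \<open>t \<noteq> 0\<close> by auto
  ultimately have "card ?E \<le> card {0..<\<bar>t\<bar>}"
    by (intro card_inj_on_le) auto
  then show ?thesis by simp
qed

text \<open>
  The bound on the number of boundary points involves only the pieces and the step lengths
  \<open>t I\<close>, not \<open>\<alpha>\<close>, \<open>M\<close> or \<open>P\<close>. On each piece the admissible \<open>m\<close> form an interval of
  integers, which the step \<open>t I\<close> leaves at most \<open>\<bar>t I\<bar>\<close> times in either direction. On a piece of
  slope zero every point may be a boundary point, but all of them share the value \<open>b I\<close>.
\<close>

lemma few_boundary_values:
  fixes \<I> :: "real set set" and a b :: "real set \<Rightarrow> real" and t :: "real set \<Rightarrow> int"
    and c \<alpha> P :: real and M :: nat
  assumes fin: "finite \<I>" and cover: "\<Union>\<I> = UNIV"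
    and int: "\<And>I. I \<in> \<I> \<Longrightarrow> is_interval I"
    and f: "\<And>I x. I \<in> \<I> \<Longrightarrow> x \<in> I \<Longrightarrow> f x = a I * x + b I"
    and t: "\<And>I. I \<in> \<I> \<Longrightarrow> t I \<noteq> 0"
    and c: "\<And>I. I \<in> \<I> \<Longrightarrow> a I \<noteq> 0 \<Longrightarrow> c = a I * of_int (t I)"
    and "\<alpha> > 0"
  defines "A \<equiv> (\<lambda>m::int. f (of_int m * \<alpha>)) ` {1..int M}"
  obtains F where "finite F" "card F \<le> (\<Sum>I\<in>\<I>. 1 + 2 * nat \<bar>t I\<bar>)"
    "\<forall>x\<in>periodize P A. x + c * \<alpha> \<notin> periodize P A \<longrightarrow> x \<in> periodize P F"
    "\<forall>x\<in>periodize P A. x - c * \<alpha> \<notin> periodize P A \<longrightarrow> x \<in> periodize P F"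
proof -
  define g where "g = (\<lambda>m::int. f (of_int m * \<alpha>))"
  define J where "J I = {m \<in> {1..int M}. of_int m * \<alpha> \<in> I}" for I
  define E where "E I s = {m \<in> J I. m + s \<notin> J I}" for I s
  define F where "F = (\<Union>I\<in>\<I>. insert (b I) (g ` (E I (t I) \<union> E I (- t I))))"
  have finE: "finite (E I s)" for I s
    by (rule finite_subset[of _ "{1..int M}"]) (auto simp: E_def J_def)
  have cardE: "card (E I s) \<le> nat \<bar>s\<bar>" if "I \<in> \<I>" "s \<noteq> 0" for I s
    unfolding E_def
  proof (rule card_exits_of_order_convex_le[OF _ \<open>s \<noteq> 0\<close>])
    fix x y z assume xz: "x \<in> J I" "z \<in> J I" and "x \<le> y" "y \<le> z"
    then have "of_int x * \<alpha> \<le> of_int y * \<alpha>" "of_int y * \<alpha> \<le> of_int z * \<alpha>"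
      using \<open>\<alpha> > 0\<close> by simp_all
    then have "of_int y * \<alpha> \<in> I"
      using int[OF \<open>I \<in> \<I>\<close>] xz unfolding is_interval_1 J_def by blast
    then show "y \<in> J I" using xz \<open>x \<le> y\<close> \<open>y \<le> z\<close> by (auto simp: J_def)
  qed
  have "card F \<le> (\<Sum>I\<in>\<I>. card (insert (b I) (g ` (E I (t I) \<union> E I (- t I)))))"
    unfolding F_def using fin by (rule card_UN_le)
  also have "\<dots> \<le> (\<Sum>I\<in>\<I>. 1 + 2 * nat \<bar>t I\<bar>)"
  proof (rule sum_mono)
    fix I assume I: "I \<in> \<I>"
    let ?E = "E I (t I) \<union> E I (- t I)"
    have "card (insert (b I) (g ` ?E)) \<le> Suc (card (g ` ?E))"
      using finE by (simp add: card_insert_if)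
    also have "card (g ` ?E) \<le> card ?E" using finE by (intro card_image_le) auto
    also have "card ?E \<le> card (E I (t I)) + card (E I (- t I))" by (rule card_Un_le)
    also have "\<dots> \<le> nat \<bar>t I\<bar> + nat \<bar>t I\<bar>"
      using cardE[OF I, of "t I"] cardE[OF I, of "- t I"] t[OF I] by simp
    finally show "card (insert (b I) (g ` ?E)) \<le> 1 + 2 * nat \<bar>t I\<bar>" by simp
  qed
  finally have cardF: "card F \<le> (\<Sum>I\<in>\<I>. 1 + 2 * nat \<bar>t I\<bar>)" .
  \<comment> \<open>The sign \<open>e\<close> treats translation by \<open>c * \<alpha>\<close> and by \<open>- c * \<alpha>\<close> together.\<close>
  have boundary: "x \<in> periodize P F"
    if x: "x \<in> periodize P A" and out: "x + of_int e * (c * \<alpha>) \<notin> periodize P A"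
      and e: "e = 1 \<or> e = - 1" for x and e :: int
  proof -
    obtain v k where "v \<in> A" and xv: "x = v + of_int k * P"
      using x unfolding periodize_def by blast
    then obtain m where m: "m \<in> {1..int M}" and "v = g m"
      unfolding A_def g_def by blast
    then have xm: "x = g m + of_int k * P" using xv by simp
    obtain I where I: "I \<in> \<I>" "of_int m * \<alpha> \<in> I" using cover by blast
    have "g m \<in> F"
    proof (cases "a I = 0")
      case True
      then have "g m = b I" using f[OF I] by (simp add: g_def)
      then show ?thesis using I by (auto simp: F_def)
    next
      case False
      have "m + e * t I \<notin> J I"
      proof
        assume m': "m + e * t I \<in> J I"
        then have "g (m + e * t I) = a I * (of_int (m + e * t I) * \<alpha>) + b I"
          using f[OF I(1)] by (simp add: g_def J_def)
        also have "\<dots> = g m + of_int e * (c * \<alpha>)"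
          using f[OF I] c[OF I(1) False] by (simp add: g_def algebra_simps)
        finally have "x + of_int e * (c * \<alpha>) = g (m + e * t I) + of_int k * P"
          using xm by simp
        moreover have "g (m + e * t I) \<in> A"
          using m' unfolding A_def g_def J_def by blast
        ultimately show False using out unfolding periodize_def by blast
      qed
      then have "m \<in> E I (t I) \<union> E I (- t I)"
        using e m I(2) by (auto simp: E_def J_def)
      then show ?thesis using I(1) by (auto simp: F_def)
    qed
    then show ?thesis using xm unfolding periodize_def by blast
  qed
  show thesis
    by (rule that[of F]) (use cardF fin finE boundary[of _ 1] boundary[of _ "- 1"] in \<open>auto simp: F_def\<close>)
qed

section \<open>From sorted lists to periodic sets\<close>

text \<open>
  The list shows one period of the periodic set, so consecutive distinct entries are consecutive in
  the whole set; only repeated entries give a difference that is not the length of a gap.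
\<close>

lemma successive_gaps_sort_rmod:
  assumes "P > 0" "xs = sort (map (\<lambda>y. y rmod P) ys)"
  shows "successive_gaps xs \<subseteq> insert 0 {y - x | x y. consecutive_in (periodize P (set ys)) x y}"
proof
  let ?S = "periodize P (set ys)"
  have sorted: "sorted xs" using assms by simp
  have mem: "z \<in> set xs \<longleftrightarrow> z \<in> ?S \<and> 0 \<le> z \<and> z < P" for z
  proof -
    have "z \<in> set xs \<longleftrightarrow> (\<exists>v\<in>set ys. z \<in> {0..<P} \<and> (\<exists>k::int. v - z = of_int k * P))"
      using assms by (auto simp: image_iff rmod_in_interval_unique[OF \<open>P > 0\<close>])
    moreover have "(\<exists>k::int. v - z = of_int k * P) \<longleftrightarrow> (\<exists>k::int. z = v + of_int k * P)" for v
    proof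
      assume "\<exists>k::int. v - z = of_int k * P"
      then obtain k :: int where "v - z = of_int k * P" ..
      then have "z = v + of_int (- k) * P" by simp
      then show "\<exists>k::int. z = v + of_int k * P" ..
    next
      assume "\<exists>k::int. z = v + of_int k * P"
      then obtain k :: int where "z = v + of_int k * P" ..
      then have "v - z = of_int (- k) * P" by simp
      then show "\<exists>k::int. v - z = of_int k * P" ..
    qed
    ultimately show ?thesis by (auto simp: periodize_def)
  qed
  fix l assume "l \<in> successive_gaps xs"
  then obtain i where i: "Suc i < length xs" and l: "l = xs ! Suc i - xs ! i"
    by (auto simp: successive_gaps_def)
  have le: "xs ! i \<le> xs ! Suc i" using sorted i by (simp add: sorted_nth_mono)
  have ends: "xs ! i \<in> set xs" "xs ! Suc i \<in> set xs" using i by auto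
  have "z \<notin> ?S" if z: "xs ! i < z" "z < xs ! Suc i" for z
  proof
    assume "z \<in> ?S"
    then have "z \<in> set xs" using z ends mem by force
    then obtain j where j: "j < length xs" "z = xs ! j" by (auto simp: in_set_conv_nth)
    show False
    proof (cases "j \<le> i")
      case True
      then show False using sorted_nth_mono[OF sorted, of j i] i j z by auto
    next
      case False
      then show False using sorted_nth_mono[OF sorted, of "Suc i" j] j z by auto
    qed
  qed
  then have "l \<noteq> 0 \<Longrightarrow> consecutive_in ?S (xs ! i) (xs ! Suc i)"
    using le l ends mem by (auto simp: consecutive_in_def)
  then show "l \<in> insert 0 {y - x | x y. consecutive_in ?S x y}"
    using l by blast
qed

theorem corollary1p3:
  fixes f :: "real \<Rightarrow> real"
  assumes "piecewise_linear_rational_slopes f"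
  shows "\<exists>k::nat. \<forall>(\<alpha>::real) (M::nat) (P::real).
           \<alpha> > 0 \<longrightarrow> \<alpha> \<notin> \<rat> \<longrightarrow> M > 1 \<longrightarrow> P > 0 \<longrightarrow> P \<in> \<rat> \<longrightarrow>
           card (successive_gaps (sorted_values_mod f \<alpha> M P)) \<le> k"
proof -
  obtain \<I> where fin: "finite \<I>" and part: "partition_on UNIV \<I>"
    and pieces: "\<forall>I\<in>\<I>. is_interval I \<and> (\<exists>a\<in>\<rat>. \<exists>b::real. \<forall>x\<in>I. f x = a * x + b)"
    using assms unfolding piecewise_linear_rational_slopes_def by blast
  have intervals: "\<And>I. I \<in> \<I> \<Longrightarrow> is_interval I" using pieces by blast
  have cover: "\<Union>\<I> = UNIV" using part by (simp add: partition_on_def)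
  obtain a b where a: "\<And>I. I \<in> \<I> \<Longrightarrow> a I \<in> \<rat>"
    and f: "\<And>I x. I \<in> \<I> \<Longrightarrow> x \<in> I \<Longrightarrow> f x = a I * x + b I"
    using pieces by metis
  have "\<exists>c\<in>\<rat> - {0}. \<forall>r\<in>a ` \<I> - {0}. \<exists>t::int. t \<noteq> 0 \<and> c = r * of_int t"
    using fin a by (intro common_multiple_of_rationals) auto
  then obtain c where c: "c \<in> \<rat>" "c \<noteq> 0"
    and "\<forall>r\<in>a ` \<I> - {0}. \<exists>t::int. t \<noteq> 0 \<and> c = r * of_int t" by blast
  \<comment> \<open>For slope zero any nonzero step will do; it only has to depend on \<open>f\<close> alone.\<close>
  then have "\<exists>t::int. t \<noteq> 0 \<and> (a I \<noteq> 0 \<longrightarrow> c = a I * of_int t)" if "I \<in> \<I>" for I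
    using that by (cases "a I = 0") (auto intro: exI[of _ 1])
  then obtain t where t: "\<And>I. I \<in> \<I> \<Longrightarrow> t I \<noteq> 0"
    and ct: "\<And>I. I \<in> \<I> \<Longrightarrow> a I \<noteq> 0 \<Longrightarrow> c = a I * of_int (t I)"
    by metis
  let ?K = "\<Sum>I\<in>\<I>. 1 + 2 * nat \<bar>t I\<bar>"
  have "card (successive_gaps (sorted_values_mod f \<alpha> M P)) \<le> 3 * ?K + 1"
    if \<alpha>: "\<alpha> > 0" "\<alpha> \<notin> \<rat>" and P: "P > 0" "P \<in> \<rat>" for \<alpha> M P
  proof -
    define A where "A = (\<lambda>m::int. f (of_int m * \<alpha>)) ` {1..int M}"
    define L where "L = {y - x | x y. consecutive_in (periodize P A) x y}"
    obtain F where F: "finite F" "card F \<le> ?K"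
      "\<forall>x\<in>periodize P A. x + c * \<alpha> \<notin> periodize P A \<longrightarrow> x \<in> periodize P F"
      "\<forall>x\<in>periodize P A. x - c * \<alpha> \<notin> periodize P A \<longrightarrow> x \<in> periodize P F"
      unfolding A_def
      by (rule few_boundary_values[OF fin cover intervals f t ct \<alpha>(1), where P = P and M = M])
    have irr: "n = 0" if "of_nat n * (c * \<alpha>) = of_int k * P" for n k
    proof (rule ccontr)
      assume "n \<noteq> 0"
      then have "\<alpha> = of_int k * P / (of_nat n * c)" using that c by (simp add: field_simps)
      then show False using \<alpha> P c by simp
    qed
    have L: "finite L \<and> card L \<le> 3 * card F"
      unfolding L_def
      using P F irr by (intro card_gap_lengths_le[where \<beta> = "c * \<alpha>"]) (auto simp: A_def)
    define ys where "ys = map (\<lambda>m. f (real m * \<alpha>)) [1..<Suc M]"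
    have "set ys = (\<lambda>m. f (real m * \<alpha>)) ` {1..M}"
      unfolding ys_def by (auto simp: atLeastLessThanSuc_atLeastAtMost simp del: upt_Suc)
    also have "\<dots> = (\<lambda>m::int. f (of_int m * \<alpha>)) ` int ` {1..M}"
      by (simp add: image_image)
    also have "\<dots> = A" by (simp add: A_def image_int_atLeastAtMost)
    finally have "set ys = A" .
    moreover have "sorted_values_mod f \<alpha> M P = sort (map (\<lambda>y. y rmod P) ys)"
      by (simp add: sorted_values_mod_def ys_def o_def del: upt_Suc)
    ultimately have "successive_gaps (sorted_values_mod f \<alpha> M P) \<subseteq> insert 0 L"
      using successive_gaps_sort_rmod[OF P(1), of "sorted_values_mod f \<alpha> M P" ys]
      by (simp add: L_def)
    then have "card (successive_gaps (sorted_values_mod f \<alpha> M P)) \<le> card (insert 0 L)"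
      using L by (intro card_mono) auto
    also have "\<dots> \<le> card L + 1" using L by (simp add: card_insert_if)
    finally show ?thesis using L F(2) by linarith
  qed
  then show ?thesis by blast
qed

end
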